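(* Let $G$ be an $(r,z)$-regular mixed graph with diameter $k\ge 3$. Then the order (number of vertices) $N$ of $G$ satisfies the bound $$N\le M(r,z,k)-r,$$ where $M(r,z,k)$ is the Moore bound for mixed graphs.
   Context: A mixed graph $G=(V,E,A)$ consists of a set $V$ of vertices, a set $E$ of edges (unordered pairs of vertices) and a set $A$ of arcs (ordered pairs of vertices). Equivalently, $G$ can be seen as a digraph in which each edge is a digon (pair of opposite arcs). The undirected degree $r(u)$ of a vertex $u$ is the number of edges incident to $u$; the out-degree $z^+(u)$ (respectively, in-degree $z^-(u)$) is the number of arcs emanating from (respectively, to) $u$. $G$ is $(r,z)$-regular (totally regular of degrees $(r,z)$) if $r(u)=r$ and $z^+(u)=z^-(u)=z$ for all $u\in V$. The distance $\mathrm{dist}(u,v)$ is the length of a shortest path from $u$ to $v$, where edges can be traversed in both directions and arcs only in their direction; the diameter is the maximum of $\mathrm{dist}(u,v)$ over all ordered pairs of vertices. The Moore bound is $$M(r,z,k)=A\frac{u_1^{k+1}-1}{u_1-1}+B\frac{u_2^{k+1}-1}{u_2-1},$$ where $v=(z+r)^2+2(z-r)+1$, $u_1=\frac{z+r-1-\sqrt v}{2}$, $u_2=\frac{z+r-1+\sqrt v}{2}$, $A=\frac{\sqrt v-(z+r+1)}{2\sqrt v}$, $B=\frac{\sqrt v+(z+r+1)}{2\sqrt v}$ (in these formulas $A$ and $v$ denote numbers, not the arc set or a vertex; a quotient $\frac{x^{k+1}-1}{x-1}$ with $x=1$ is read as $\sum_{i=0}^k x^i=k+1$). Equivalently, $M(r,z,k)=\sum_{i=0}^k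 N_i$, where $N_0=1$, $N_1=r+z$ and $N_i=(r+z-1)N_{i-1}+zN_{i-2}$ for $i\ge 2$; here $N_i$ is the maximum possible number of vertices at distance $i$ from a given vertex, counted in the tree of depth $k$ in which every vertex is reached from the root by a unique path of length at most $k$.
   Formalization: The formal theorem assumes z ≥ 1, so that G really contains arcs; for z = 0 the claim fails, e.g. for the 7-cycle with r = 2, z = 0, k = 3, where N = 7 = M(2,0,3) > M(2,0,3) − 2. *)

theory Defs
  imports Complex_Main "HOL-Library.Extended_Nat"
begin

text \<open>
  Arcs are arbitrary ordered pairs of vertices: loops, opposite pairs of arcs, and arcs parallel
  to an edge are not excluded. Edges join two distinct vertices.
\<close>

locale mixed_graph =
  fixes V :: "'a set" and E :: "'a set set" and A :: "('a \<times> 'a) set"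
  assumes finite_vertices: "finite V"
    and edges: "e \<in> E \<Longrightarrow> \<exists>u\<in>V. \<exists>v\<in>V. u \<noteq> v \<and> e = {u, v}"
    and arcs: "A \<subseteq> V \<times> V"

definition undirected_degree :: "'a set set \<Rightarrow> 'a \<Rightarrow> nat" where
  "undirected_degree E u = card {e \<in> E. u \<in> e}"

definition out_degree :: "('a \<times> 'a) set \<Rightarrow> 'a \<Rightarrow> nat" where
  "out_degree A u = card {a \<in> A. fst a = u}"

definition in_degree :: "('a \<times> 'a) set \<Rightarrow> 'a \<Rightarrow> nat" where
  "in_degree A u = card {a \<in> A. snd a = u}"

definition totally_regular ::
    "'a set \<Rightarrow> 'a set set \<Rightarrow> ('a \<times> 'a) set \<Rightarrow> nat \<Rightarrow> nat \<Rightarrow> bool" where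
  "totally_regular V E A r z \<longleftrightarrow>
     (\<forall>u\<in>V. undirected_degree E u = r \<and> out_degree A u = z \<and> in_degree A u = z)"

definition mixed_path ::
    "'a set \<Rightarrow> 'a set set \<Rightarrow> ('a \<times> 'a) set \<Rightarrow> 'a \<Rightarrow> 'a list \<Rightarrow> 'a \<Rightarrow> bool" where
  "mixed_path V E A u p v \<longleftrightarrow>
     p \<noteq> [] \<and> hd p = u \<and> last p = v \<and> set p \<subseteq> V \<and> distinct p \<and>
     successively (\<lambda>x y. {x, y} \<in> E \<or> (x, y) \<in> A) p"

text \<open>
  A path is given by its list of vertices, so its length is one less than the length of the list.
  The distance is \<open>\<infinity>\<close> if there is no path; hence a finite diameter entails that every vertex is
  reachable from every other one.
\<close>

definition mixed_dist ::
    "'a set \<Rightarrow> 'a set set \<Rightarrow> ('a \<times> 'a) set \<Rightarrow> 'a \<Rightarrow> 'a \<Rightarrow> enat" where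
  "mixed_dist V E A u v = (INF p \<in> {p. mixed_path V E A u p v}. enat (length p - 1))"

definition mixed_diameter :: "'a set \<Rightarrow> 'a set set \<Rightarrow> ('a \<times> 'a) set \<Rightarrow> enat" where
  "mixed_diameter V E A = (SUP (u, v) \<in> V \<times> V. mixed_dist V E A u v)"

text \<open>The quotient \<open>(x\<^sup>k\<^sup>+\<^sup>1 - 1) / (x - 1)\<close>, read as \<open>1 + x + \<dots> + x\<^sup>k = k + 1\<close> at \<open>x = 1\<close>.\<close>

definition geometric_quotient :: "real \<Rightarrow> nat \<Rightarrow> real" where
  "geometric_quotient x k = (if x = 1 then real (k + 1) else (x ^ (k + 1) - 1) / (x - 1))"

definition moore_bound :: "nat \<Rightarrow> nat \<Rightarrow> nat \<Rightarrow> real" where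
  "moore_bound r z k =
     (let v = (real z + real r)^2 + 2 * (real z - real r) + 1;
          u1 = (real z + real r - 1 - sqrt v) / 2;
          u2 = (real z + real r - 1 + sqrt v) / 2;
          A = (sqrt v - (real z + real r + 1)) / (2 * sqrt v);
          B = (sqrt v + (real z + real r + 1)) / (2 * sqrt v)
      in A * geometric_quotient u1 k + B * geometric_quotient u2 k)"

end

theory Submission
  imports Defs
begin

text \<open>
  Fix a vertex \<open>u\<close> and consider the walks of length at most \<open>k\<close> from \<open>u\<close> that never traverse an
  edge forth and at once back. Total regularity makes their number exactly \<open>M(r,z,k)\<close>, and the
  diameter makes every vertex \<open>w\<close> the end of at least one of them. If \<open>n w\<close> of them end at \<open>w\<close>, the
  claim is therefore that the total excess \<open>\<Sum>\<^sub>w (n w - 1)\<close> is at least \<open>r\<close>. This is shown by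
  distributing the \<open>r z\<close> walks \<open>u - x \<rightarrow> y\<close> (an edge, then an arc) over the vertices in such a way
  that no vertex \<open>w\<close> receives more than \<open>z (n w - 1)\<close> of them; then \<open>r z \<le> z \<Sum>\<^sub>w (n w - 1)\<close>.

  If \<open>n y \<ge> 2\<close>, the walk \<open>u - x \<rightarrow> y\<close> is charged to \<open>y\<close> itself; at most \<open>z\<close> walks, and at most
  \<open>n y\<close> of them, are charged to \<open>y\<close> in this way, and nothing else is. Suppose \<open>n y = 1\<close>, so that
  \<open>u - x \<rightarrow> y\<close> is the only walk to \<open>y\<close>. Each of the \<open>z\<close> out-neighbours \<open>a\<close> of \<open>u\<close> reaches \<open>y\<close> within
  \<open>k\<close> steps, and not in fewer than \<open>k\<close> of them, since \<open>u \<rightarrow> a \<dots> y\<close> would be a second walk. So there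
  are \<open>z\<close> walks of length \<open>k + 1\<close> to \<open>y\<close> with different first arcs. If one of them
  arrives by an edge \<open>w - y\<close>, charge \<open>w\<close>, which has an arc-first walk of length \<open>k\<close> besides
  \<open>u - x \<rightarrow> y - w\<close>. Otherwise all arrive through the \<open>z\<close> in-neighbours of \<open>y\<close>, one of which is
  \<open>x\<close>. Either two arrive through the same in-neighbour \<open>w\<close>, or one arrives through \<open>w = x\<close>, which
  also has the walk \<open>u - x\<close>; charge this \<open>w\<close> (lemma \<open>charge_exists\<close>). A vertex charged by \<open>p\<close>
  walks through an edge has \<open>n w - 1 \<ge> p\<close>, and \<open>n w - 1 \<ge> p + 1\<close> if it is also charged through
  an arc, which happens at most \<open>z\<close> times; so its load is at most \<open>z (n w - 1)\<close> (lemma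
  \<open>load_le\<close>).
  The condition \<open>k \<ge> 3\<close> makes the three-step walks such as \<open>u - x \<rightarrow> y - w\<close> count.
\<close>

section \<open>The Moore bound as a sum of level sizes\<close>

text \<open>
  The number of ways to continue for \<open>i\<close> more steps: \<open>free_count\<close> at the root or after an arc,
  \<open>edge_count\<close> after an edge, which must not be traversed back. The values are real, so that
  \<open>r - 1\<close> is not truncated at \<open>r = 0\<close> and the recurrence below holds for all \<open>r\<close>.
\<close>

fun free_count :: "nat \<Rightarrow> nat \<Rightarrow> nat \<Rightarrow> real" and edge_count :: "nat \<Rightarrow> nat \<Rightarrow> nat \<Rightarrow> real" where
  "free_count r z 0 = 1"
| "free_count r z (Suc i) = real r * edge_count r z i + real z * free_count r z i"
| "edge_count r z 0 = 1"
| "edge_count r z (Suc i) = (real r - 1) * edge_count r z i + real z * free_count r z i"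

lemma free_count_recurrence:
  "free_count r z (Suc (Suc i)) =
     (real r + real z - 1) * free_count r z (Suc i) + real z * free_count r z i"
  by (simp add: algebra_simps)

lemma sum_power_eq_geometric_quotient: "(\<Sum>i\<le>k. x ^ i) = geometric_quotient x k"
  by (auto simp: geometric_quotient_def sum_gp0 divide_simps) (simp add: algebra_simps)

text \<open>
  The Moore bound is built from the two roots of the characteristic polynomial
  \<open>x\<^sup>2 - (r + z - 1) x - z\<close> of the recurrence; they differ because \<open>z \<ge> 1\<close>.
\<close>

lemma sum_free_count_eq_moore_bound:
  assumes "z \<ge> 1"
  shows "(\<Sum>i\<le>k. free_count r z i) = moore_bound r z k"
proof -
  define v where "v = (real z + real r)^2 + 2 * (real z - real r) + 1"
  define w where "w = sqrt v"
  define u1 where "u1 = (real z + real r - 1 - w) / 2"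
  define u2 where "u2 = (real z + real r - 1 + w) / 2"
  define A where "A = (w - (real z + real r + 1)) / (2 * w)"
  define B where "B = (w + (real z + real r + 1)) / (2 * w)"
  have v_eq: "v = (real z + real r - 1)^2 + 4 * real z"
    by (simp add: v_def power2_eq_square algebra_simps)
  have "v > 0"
    unfolding v_eq using assms by (simp add: add_nonneg_pos)
  then have w: "w > 0" "w * w = v"
    by (simp_all add: w_def)
  have root1: "u1 * u1 = (real r + real z - 1) * u1 + real z"
    and root2: "u2 * u2 = (real r + real z - 1) * u2 + real z"
    using w(2) by (simp_all add: u1_def u2_def v_eq field_simps power2_eq_square)
  have "free_count r z i = A * u1 ^ i + B * u2 ^ i
      \<and> free_count r z (Suc i) = A * u1 ^ Suc i + B * u2 ^ Suc i" for i
  proof (induction i)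
    case 0
    show ?case
      using w(1) by (simp add: A_def B_def u1_def u2_def field_simps)
  next
    case (Suc i)
    have "A * u1 ^ Suc (Suc i) + B * u2 ^ Suc (Suc i)
        = A * u1 ^ i * (u1 * u1) + B * u2 ^ i * (u2 * u2)"
      by simp
    also have "\<dots> = (real r + real z - 1) * (A * u1 ^ Suc i + B * u2 ^ Suc i)
        + real z * (A * u1 ^ i + B * u2 ^ i)"
      unfolding root1 root2 by (simp add: algebra_simps)
    finally have "free_count r z (Suc (Suc i)) = A * u1 ^ Suc (Suc i) + B * u2 ^ Suc (Suc i)"
      using Suc by (simp only: free_count_recurrence)
    with Suc show ?case
      by blast
  qed
  then have "(\<Sum>i\<le>k. free_count r z i) = (\<Sum>i\<le>k. A * u1 ^ i + B * u2 ^ i)"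
    by simp
  also have "\<dots> = A * geometric_quotient u1 k + B * geometric_quotient u2 k"
    by (simp add: sum.distrib sum_distrib_left[symmetric] sum_power_eq_geometric_quotient)
  also have "\<dots> = moore_bound r z k"
    by (simp add: moore_bound_def Let_def A_def B_def u1_def u2_def w_def v_def)
  finally show ?thesis .
qed

section \<open>Walks without reversed edges\<close>

text \<open>
  A walk is the list of its steps; a step \<open>(True, y)\<close> goes along an edge to \<open>y\<close>, and
  \<open>(False, y)\<close> along an arc, so that an edge and an arc with the same ends are told apart. The
  option argument is the vertex to which no edge may be followed, because an edge was just
  traversed from there.
\<close>

fun nb_walk :: "'a set set \<Rightarrow> ('a \<times> 'a) set \<Rightarrow> 'a option \<Rightarrow> 'a \<Rightarrow> (bool \<times> 'a) list \<Rightarrow> bool" where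
  "nb_walk E A b x [] \<longleftrightarrow> True"
| "nb_walk E A b x ((True, y) # s) \<longleftrightarrow> {x, y} \<in> E \<and> b \<noteq> Some y \<and> nb_walk E A (Some x) y s"
| "nb_walk E A b x ((False, y) # s) \<longleftrightarrow> (x, y) \<in> A \<and> nb_walk E A None y s"

definition walk_end :: "'a \<Rightarrow> (bool \<times> 'a) list \<Rightarrow> 'a" where
  "walk_end x s = last (x # map snd s)"

lemma walk_end_simps [simp]:
  "walk_end x [] = x" "walk_end x (p # s) = walk_end (snd p) s" "walk_end x (s @ [p]) = snd p"
  by (simp_all add: walk_end_def)

lemma nb_walk_snoc:
  "nb_walk E A b x (s @ [(e, y)]) \<Longrightarrow>
     nb_walk E A b x s \<and> (if e then {walk_end x s, y} \<in> E else (walk_end x s, y) \<in> A)"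
  by (induction E A b x s rule: nb_walk.induct) (cases e; auto)+

text \<open>A path repeats no vertex, so it cannot reverse an edge, whichever kind of step is chosen
  between vertices joined both by an edge and by an arc.\<close>

lemma nb_walk_of_distinct:
  assumes "successively (\<lambda>x y. {x, y} \<in> E \<or> (x, y) \<in> A) (x # p)" and "distinct (x # p)"
    and "\<And>c. b = Some c \<Longrightarrow> c \<notin> set p"
  shows "\<exists>s. nb_walk E A b x s \<and> map snd s = p"
  using assms
proof (induction p arbitrary: b x)
  case Nil
  show ?case by (rule exI[of _ "[]"]) simp
next
  case (Cons y p)
  have step: "{x, y} \<in> E \<or> (x, y) \<in> A" and b: "b \<noteq> Some y"
    using Cons.prems by auto
  show ?case
  proof (cases "{x, y} \<in> E")
    case True
    obtain s where "nb_walk E A (Some x) y s" "map snd s = p"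
      using Cons.IH[of y "Some x"] Cons.prems by auto
    then show ?thesis
      using True b by (intro exI[of _ "(True, y) # s"]) simp
  next
    case False
    obtain s where "nb_walk E A None y s" "map snd s = p"
      using Cons.IH[of y None] Cons.prems by auto
    then show ?thesis
      using False step by (intro exI[of _ "(False, y) # s"]) simp
  qed
qed

locale regular_mixed_graph = mixed_graph V E A
  for V :: "'a set" and E :: "'a set set" and A :: "('a \<times> 'a) set" +
  fixes r z :: nat
  assumes regular: "totally_regular V E A r z"
begin

lemma edge_ends: "{x, y} \<in> E \<Longrightarrow> x \<in> V \<and> y \<in> V"
  using edges[of "{x, y}"] by (auto simp: doubleton_eq_iff)

lemma arc_ends: "(x, y) \<in> A \<Longrightarrow> x \<in> V \<and> y \<in> V"
  using arcs by auto

lemma finite_neighbours [simp]: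
  "finite {y. {x, y} \<in> E}" "finite {y. (x, y) \<in> A}" "finite {y. (y, x) \<in> A}"
  by (auto intro!: finite_subset[OF _ finite_vertices] dest: edge_ends arc_ends)

lemma card_edge_neighbours:
  assumes "x \<in> V"
  shows "card {y. {x, y} \<in> E} = r"
proof -
  have "bij_betw (\<lambda>y. {x, y}) {y. {x, y} \<in> E} {e \<in> E. x \<in> e}"
    unfolding bij_betw_def
  proof
    show "inj_on (\<lambda>y. {x, y}) {y. {x, y} \<in> E}"
      by (auto simp: inj_on_def doubleton_eq_iff)
    show "(\<lambda>y. {x, y}) ` {y. {x, y} \<in> E} = {e \<in> E. x \<in> e}"
    proof
      show "{e \<in> E. x \<in> e} \<subseteq> (\<lambda>y. {x, y}) ` {y. {x, y} \<in> E}"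
      proof
        fix e assume e: "e \<in> {e \<in> E. x \<in> e}"
        then obtain a b where "e = {a, b}"
          using edges by blast
        with e obtain y where "e = {x, y}"
          by (auto simp: insert_commute)
        with e show "e \<in> (\<lambda>y. {x, y}) ` {y. {x, y} \<in> E}"
          by auto
      qed
    qed auto
  qed
  then show ?thesis
    using assms regular
    by (auto simp: totally_regular_def undirected_degree_def dest: bij_betw_same_card)
qed

lemma card_out_neighbours:
  assumes "x \<in> V"
  shows "card {y. (x, y) \<in> A} = z"
proof -
  have "{a \<in> A. fst a = x} = Pair x ` {y. (x, y) \<in> A}"
    by auto
  then show ?thesis
    using assms regular
    by (auto simp: totally_regular_def out_degree_def card_image inj_on_def)
qed

lemma card_in_neighbours:
  assumes "x \<in> V"
  shows "card {y. (y, x) \<in> A} = z"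
proof -
  have "{a \<in> A. snd a = x} = (\<lambda>y. (y, x)) ` {y. (y, x) \<in> A}"
    by auto
  then show ?thesis
    using assms regular
    by (auto simp: totally_regular_def in_degree_def card_image inj_on_def)
qed

lemma nb_walk_end_in_V: "nb_walk E A b x s \<Longrightarrow> x \<in> V \<Longrightarrow> walk_end x s \<in> V"
proof (induction s arbitrary: b x)
  case (Cons p s)
  obtain e y where p: "p = (e, y)"
    by (cases p)
  have "y \<in> V"
    using Cons.prems edge_ends[of x y] arc_ends[of x y] by (cases e) (auto simp: p)
  then show ?case
    using Cons by (cases e) (auto simp: p)
qed simp

definition walks :: "'a option \<Rightarrow> 'a \<Rightarrow> nat \<Rightarrow> (bool \<times> 'a) list set" where
  "walks b x i = {s. length s = i \<and> nb_walk E A b x s}"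

lemma walks_0: "walks b x 0 = {[]}"
  by (auto simp: walks_def)

lemma walks_Suc:
  "walks b x (Suc i) =
     (\<lambda>(y, s). (True, y) # s) ` (SIGMA y:{y. {x, y} \<in> E \<and> b \<noteq> Some y}. walks (Some x) y i) \<union>
     (\<lambda>(y, s). (False, y) # s) ` (SIGMA y:{y. (x, y) \<in> A}. walks None y i)"
  (is "?L = ?R1 \<union> ?R2")
proof
  show "?L \<subseteq> ?R1 \<union> ?R2"
  proof
    fix s assume s: "s \<in> ?L"
    then obtain e y t where "s = (e, y) # t"
      by (cases s) (auto simp: walks_def)
    with s show "s \<in> ?R1 \<union> ?R2"
      by (cases e) (auto simp: walks_def image_iff)
  qed
  show "?R1 \<union> ?R2 \<subseteq> ?L"
    by (auto simp: walks_def)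
qed

lemma finite_walks: "finite (walks b x i)"
proof (induction i arbitrary: b x)
  case (Suc i)
  have "finite {y. {x, y} \<in> E \<and> b \<noteq> Some y}"
    by (rule finite_subset[OF _ finite_neighbours(1)[of x]]) auto
  then show ?case
    using Suc by (simp add: walks_Suc)
qed (simp add: walks_0)

lemma card_walks_Suc:
  "card (walks b x (Suc i)) =
     (\<Sum>y\<in>{y. {x, y} \<in> E \<and> b \<noteq> Some y}. card (walks (Some x) y i)) +
     (\<Sum>y\<in>{y. (x, y) \<in> A}. card (walks None y i))"
proof -
  have fin: "finite {y. {x, y} \<in> E \<and> b \<noteq> Some y}"
    by (rule finite_subset[OF _ finite_neighbours(1)[of x]]) auto
  show ?thesis
    unfolding walks_Suc
    by (subst card_Un_disjoint)
      (auto simp: fin finite_walks card_image inj_on_def)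
qed

lemma card_walks:
  "x \<in> V \<Longrightarrow> real (card (walks None x i)) = free_count r z i
    \<and> (\<forall>c. {x, c} \<in> E \<longrightarrow> real (card (walks (Some c) x i)) = edge_count r z i)"
proof (induction i arbitrary: x)
  case 0
  show ?case by (simp add: walks_0)
next
  case (Suc i)
  have edge: "real (card (walks (Some x) y i)) = edge_count r z i" if "{x, y} \<in> E" for y
    using Suc.IH[of y] that edge_ends[OF that] by (auto simp: insert_commute)
  have arc: "real (card (walks None y i)) = free_count r z i" if "(x, y) \<in> A" for y
    using Suc.IH[of y] arc_ends[OF that] by auto
  have count: "real (card (walks b x (Suc i))) =
      real (card {y. {x, y} \<in> E \<and> b \<noteq> Some y}) * edge_count r z i + real z * free_count r z i"
    for b
    by (simp add: card_walks_Suc edge arc card_out_neighbours[OF Suc.prems])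
  have "real (card {y. {x, y} \<in> E \<and> Some c \<noteq> Some y}) = real r - 1" if "{x, c} \<in> E" for c
  proof -
    have "{y. {x, y} \<in> E \<and> Some c \<noteq> Some y} = {y. {x, y} \<in> E} - {c}"
      by auto
    moreover have "r \<ge> 1"
      using that card_edge_neighbours[OF Suc.prems] card_gt_0_iff[of "{y. {x, y} \<in> E}"]
      by (auto simp: Suc_le_eq)
    ultimately show ?thesis
      using that card_edge_neighbours[OF Suc.prems] by (simp add: of_nat_diff)
  qed
  then show ?case
    using count[of None] count card_edge_neighbours[OF Suc.prems] by simp
qed

end

section \<open>Distributing the edge-arc walks\<close>

text \<open>All walks start at the root \<open>u\<close>. The diameter enters as \<open>reach\<close>: a shortest path is a walk
  without reversed edges.\<close>

locale rooted_mixed_graph = regular_mixed_graph V E A r z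
  for V :: "'a set" and E :: "'a set set" and A :: "('a \<times> 'a) set" and r z :: nat +
  fixes k :: nat and u :: 'a
  assumes root: "u \<in> V"
    and reach: "\<lbrakk>x \<in> V; y \<in> V\<rbrakk> \<Longrightarrow> \<exists>s. nb_walk E A None x s \<and> length s \<le> k \<and> walk_end x s = y"
    and k_ge_3: "k \<ge> 3"
    and z_ge_1: "z \<ge> 1"
begin

definition walks_to :: "'a \<Rightarrow> (bool \<times> 'a) list set" where
  "walks_to w = {s. length s \<le> k \<and> nb_walk E A None u s \<and> walk_end u s = w}"

definition arc_first_walks :: "'a \<Rightarrow> (bool \<times> 'a) list set" where
  "arc_first_walks w = {s \<in> walks_to w. s \<noteq> [] \<and> \<not> fst (hd s)}"

definition edge_arc_pairs :: "('a \<times> 'a) set" where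
  "edge_arc_pairs = {(x, y). {u, x} \<in> E \<and> (x, y) \<in> A}"

lemma walks_to_subset: "walks_to w \<subseteq> (\<Union>i\<le>k. walks None u i)"
  by (auto simp: walks_to_def walks_def)

lemma finite_walks_to [simp]: "finite (walks_to w)"
  by (rule finite_subset[OF walks_to_subset]) (auto simp: finite_walks)

lemma finite_arc_first_walks [simp]: "finite (arc_first_walks w)"
  by (simp add: arc_first_walks_def)

lemma card_walks_to_pos: "w \<in> V \<Longrightarrow> card (walks_to w) \<ge> 1"
proof -
  assume "w \<in> V"
  then have "walks_to w \<noteq> {}"
    using reach[OF root] by (auto simp: walks_to_def)
  then show ?thesis
    by (simp add: Suc_le_eq card_gt_0_iff)
qed

lemma sum_card_walks_to: "real (\<Sum>w\<in>V. card (walks_to w)) = moore_bound r z k"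
proof -
  have "(\<Sum>w\<in>V. card (walks_to w)) = card (\<Union>w\<in>V. walks_to w)"
    by (rule card_UN_disjoint[symmetric]) (simp add: finite_vertices, simp, auto simp: walks_to_def)
  also have "(\<Union>w\<in>V. walks_to w) = (\<Union>i\<le>k. walks None u i)"
    using nb_walk_end_in_V root by (auto simp: walks_to_def walks_def)
  also have "card \<dots> = (\<Sum>i\<le>k. card (walks None u i))"
    by (rule card_UN_disjoint) (auto simp: finite_walks, auto simp: walks_def)
  finally show ?thesis
    using card_walks[OF root] sum_free_count_eq_moore_bound[OF z_ge_1] by simp
qed

lemma edge_arc_pairs_eq_Sigma:
  "edge_arc_pairs = (SIGMA x:{x. {u, x} \<in> E}. {y. (x, y) \<in> A})"
  by (auto simp: edge_arc_pairs_def)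

lemma finite_edge_arc_pairs [simp]: "finite edge_arc_pairs"
  by (simp add: edge_arc_pairs_eq_Sigma)

lemma card_edge_arc_pairs: "card edge_arc_pairs = r * z"
proof -
  have "card edge_arc_pairs = (\<Sum>x\<in>{x. {u, x} \<in> E}. card {y. (x, y) \<in> A})"
    by (simp add: edge_arc_pairs_eq_Sigma)
  also have "\<dots> = (\<Sum>x\<in>{x. {u, x} \<in> E}. z)"
    by (rule sum.cong) (auto dest: edge_ends simp: card_out_neighbours)
  finally show ?thesis
    using card_edge_neighbours[OF root] by simp
qed

lemma walk_edge: "{u, x} \<in> E \<Longrightarrow> [(True, x)] \<in> walks_to x"
  using k_ge_3 by (simp add: walks_to_def)

lemma walk_edge_arc: "(x, y) \<in> edge_arc_pairs \<Longrightarrow> [(True, x), (False, y)] \<in> walks_to y"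
  using k_ge_3 by (simp add: walks_to_def edge_arc_pairs_def)

lemma walk_edge_arc_edge:
  "(x, y) \<in> edge_arc_pairs \<Longrightarrow> {w, y} \<in> E \<Longrightarrow> [(True, x), (False, y), (True, w)] \<in> walks_to w"
  using k_ge_3 by (simp add: walks_to_def edge_arc_pairs_def insert_commute[of y w])

lemma walk_edge_arc_arc:
  "(x, y) \<in> edge_arc_pairs \<Longrightarrow> (y, w) \<in> A \<Longrightarrow> [(True, x), (False, y), (False, w)] \<in> walks_to w"
  using k_ge_3 by (simp add: walks_to_def edge_arc_pairs_def)

lemma unique_walk:
  assumes "card (walks_to y) = 1" "s \<in> walks_to y" "t \<in> walks_to y"
  shows "s = t"
proof -
  obtain a where "walks_to y = {a}"
    using assms(1) by (rule card_1_singletonE)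
  with assms(2,3) show ?thesis
    by simp
qed

definition edge_charge :: "'a \<Rightarrow> 'a \<Rightarrow> bool" where
  "edge_charge y w \<longleftrightarrow> {w, y} \<in> E \<and> card (arc_first_walks w) \<ge> 1"

text \<open>Both alternatives below give \<open>w\<close> one walk more than \<open>edge_charge\<close> does: a second arc-first
  one, or the edge \<open>u - w\<close>. This extra unit of excess pays for the arc charges to \<open>w\<close>, which come along its \<open>z\<close> out-arcs.\<close>

definition arc_charge :: "'a \<Rightarrow> 'a \<Rightarrow> bool" where
  "arc_charge y w \<longleftrightarrow> (w, y) \<in> A \<and>
     (card (arc_first_walks w) \<ge> 2 \<or> {u, w} \<in> E \<and> card (arc_first_walks w) \<ge> 1)"

text \<open>
  The walks \<open>u \<rightarrow> a \<dots> y\<close> through the \<open>z\<close> out-neighbours \<open>a\<close> of \<open>u\<close> are too long to be counted at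
  \<open>y\<close>, but they become countable after removing the last step. If all of these last steps are
  arcs and no two start from the same vertex, then they exhaust the \<open>z\<close> in-neighbours of \<open>y\<close>,
  and so one of them starts from \<open>x\<close>.
\<close>

lemma charge_exists:
  assumes xy: "(x, y) \<in> edge_arc_pairs" and one: "card (walks_to y) = 1"
  shows "\<exists>w\<in>V. edge_charge y w \<or> arc_charge y w"
proof -
  have x: "{u, x} \<in> E" "(x, y) \<in> A" and V: "x \<in> V" "y \<in> V"
    using xy by (auto simp: edge_arc_pairs_def dest: edge_ends arc_ends)
  let ?O = "{a. (u, a) \<in> A}" and ?I = "{w. (w, y) \<in> A}"
  have "\<exists>t. (False, a) # t \<in> arc_first_walks (walk_end a t)
          \<and> ({walk_end a t, y} \<in> E \<or> (walk_end a t, y) \<in> A)"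
    if a: "a \<in> ?O" for a
  proof -
    obtain s where s: "nb_walk E A None a s" "length s \<le> k" "walk_end a s = y"
      using reach[of a y] a V arc_ends[of u a] by auto
    have "length s = k"
    proof (rule ccontr)
      assume "length s \<noteq> k"
      then have "(False, a) # s \<in> walks_to y"
        using s a by (simp add: walks_to_def)
      then show False
        using unique_walk[OF one walk_edge_arc[OF xy]] by blast
    qed
    then have "s \<noteq> []"
      using k_ge_3 by auto
    then obtain t p where "s = t @ [p]"
      by (cases s rule: rev_cases) simp
    moreover obtain e y' where "p = (e, y')"
      by (cases p)
    ultimately have t: "s = t @ [(e, y)]"
      using s(3) by simp
    have "nb_walk E A None a t" "{walk_end a t, y} \<in> E \<or> (walk_end a t, y) \<in> A"
      using nb_walk_snoc[of E A None a t e y] s(1) by (auto simp: t split: if_splits)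
    moreover have "Suc (length t) \<le> k"
      using s(2) by (simp add: t)
    ultimately show ?thesis
      using a by (intro exI[of _ t]) (simp add: arc_first_walks_def walks_to_def)
  qed
  then obtain t where t: "\<forall>a\<in>?O. (False, a) # t a \<in> arc_first_walks (walk_end a (t a))
      \<and> ({walk_end a (t a), y} \<in> E \<or> (walk_end a (t a), y) \<in> A)"
    using bchoice[of ?O "\<lambda>a t. (False, a) # t \<in> arc_first_walks (walk_end a t)
      \<and> ({walk_end a t, y} \<in> E \<or> (walk_end a t, y) \<in> A)"] by blast
  define f where "f a = walk_end a (t a)" for a
  have first: "(False, a) # t a \<in> arc_first_walks (f a)"
    and last: "{f a, y} \<in> E \<or> (f a, y) \<in> A" if "a \<in> ?O" for a
    using t that by (auto simp: f_def)
  have pos: "card (arc_first_walks (f a)) \<ge> 1" if "a \<in> ?O" for a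
    using first[OF that] by (auto simp: Suc_le_eq card_gt_0_iff)
  have "\<exists>w. edge_charge y w \<or> arc_charge y w"
  proof (cases "(\<exists>a\<in>?O. {f a, y} \<in> E) \<or> \<not> inj_on f ?O")
    case True
    then show ?thesis
    proof
      assume "\<exists>a\<in>?O. {f a, y} \<in> E"
      then show ?thesis
        using pos by (auto simp: edge_charge_def)
    next
      assume "\<not> inj_on f ?O"
      then obtain a b where ab: "a \<in> ?O" "b \<in> ?O" "f a = f b" "a \<noteq> b"
        by (auto simp: inj_on_def)
      have "card {(False, a) # t a, (False, b) # t b} \<le> card (arc_first_walks (f a))"
        using first[OF ab(1)] first[OF ab(2)] ab(3) by (intro card_mono) auto
      then have "card (arc_first_walks (f a)) \<ge> 2"
        using ab(4) by simp
      then show ?thesis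
        using last[OF ab(1)] pos[OF ab(1)]
        by (auto simp: edge_charge_def arc_charge_def)
    qed
  next
    case False
    then have "f ` ?O \<subseteq> ?I" and inj: "inj_on f ?O"
      using last by auto
    moreover have "card (f ` ?O) = card ?I"
      using inj by (simp add: card_image card_out_neighbours root card_in_neighbours V)
    ultimately have "f ` ?O = ?I"
      by (intro card_subset_eq) auto
    then have "x \<in> f ` ?O"
      using x(2) by simp
    then have "card (arc_first_walks x) \<ge> 1"
      using pos by blast
    then show ?thesis
      using x unfolding arc_charge_def by blast
  qed
  then obtain w where w: "edge_charge y w \<or> arc_charge y w"
    by blast
  then have "w \<in> V"
    using edge_ends[of w y] arc_ends[of w y] by (auto simp: edge_charge_def arc_charge_def)
  with w show ?thesis
    by blast
qed

definition charged :: "'a \<times> 'a \<Rightarrow> 'a \<Rightarrow> bool" where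
  "charged p w \<longleftrightarrow>
     (if card (walks_to (snd p)) = 1 then edge_charge (snd p) w \<or> arc_charge (snd p) w
      else w = snd p)"

text \<open>
  There are two kinds of vertices. If \<open>w\<close> ends an edge-arc walk itself, no other \<open>y\<close> is charged
  to it, since that walk could be continued to a second walk to \<open>y\<close>. The load then consists of
  walks \<open>u - x \<rightarrow> w\<close>; there are at most \<open>z\<close> and at most \<open>n\<close> of them, where \<open>n \<ge> 2\<close> is the number
  of walks to \<open>w\<close>, and the smaller of \<open>z\<close> and \<open>n\<close> is at most \<open>z (n - 1)\<close>. If \<open>w\<close> ends no edge-arc
  walk, every edge charge \<open>(x, y)\<close> contributes the walk \<open>u - x \<rightarrow> y - w\<close>, and these walks add up
  with the arc-first walks to \<open>w\<close> and the possible edge \<open>u - w\<close>.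
\<close>

lemma load_le:
  assumes "L \<subseteq> edge_arc_pairs" and "\<And>p. p \<in> L \<Longrightarrow> charged p w" and wV: "w \<in> V"
  shows "card L \<le> z * (card (walks_to w) - 1)"
proof (cases "L = {}")
  case False
  have finL: "finite L"
    by (rule finite_subset[OF assms(1)]) simp
  show ?thesis
  proof (cases "\<exists>x. (x, w) \<in> edge_arc_pairs")
    case True
    then obtain x0 where x0: "(x0, w) \<in> edge_arc_pairs"
      by blast
    have L: "snd p = w \<and> card (walks_to w) \<noteq> 1" if "p \<in> L" for p
    proof -
      obtain x y where p: "p = (x, y)"
        by (cases p)
      have xy: "(x, y) \<in> edge_arc_pairs"
        using assms(1) that p by auto
      have "card (walks_to y) \<noteq> 1"
      proof
        assume one: "card (walks_to y) = 1"
        then have "edge_charge y w \<or> arc_charge y w"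
          using assms(2)[OF that] by (simp add: charged_def p)
        then have "{y, w} \<in> E \<or> (w, y) \<in> A"
          by (auto simp: edge_charge_def arc_charge_def insert_commute)
        then obtain e where "[(True, x0), (False, w), (e, y)] \<in> walks_to y"
          using walk_edge_arc_edge[OF x0, of y] walk_edge_arc_arc[OF x0, of y] by blast
        from unique_walk[OF one walk_edge_arc[OF xy] this] show False
          by simp
      qed
      then show ?thesis
        using assms(2)[OF that] by (auto simp: charged_def p)
    qed
    moreover obtain p where "p \<in> L"
      using False by blast
    ultimately have "card (walks_to w) \<noteq> 1"
      by blast
    then have n: "card (walks_to w) \<ge> 2"
      using card_walks_to_pos[OF wV] by simp
    have inj_fst: "inj_on fst L"
      by (rule inj_onI) (simp add: L prod_eq_iff)
    have L_pair: "(fst p, w) \<in> edge_arc_pairs" if "p \<in> L" for p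
      using subsetD[OF assms(1) that] L[OF that] by (cases p) simp
    have "fst ` L \<subseteq> {x. (x, w) \<in> A}"
      using L_pair by (auto simp: edge_arc_pairs_def)
    then have "card L \<le> card {x. (x, w) \<in> A}"
      by (intro card_inj_on_le[OF inj_fst]) simp_all
    then have le_z: "card L \<le> z"
      using wV by (simp add: card_in_neighbours)
    have le_n: "card L \<le> card (walks_to w)"
    proof (rule card_inj_on_le)
      show "inj_on (\<lambda>p. [(True, fst p), (False, w)]) L"
        by (rule inj_onI) (simp add: inj_onD[OF inj_fst])
      show "(\<lambda>p. [(True, fst p), (False, w)]) ` L \<subseteq> walks_to w"
        using L_pair walk_edge_arc by blast
    qed simp
    show ?thesis
    proof (cases "z = 1")
      case True
      then show ?thesis
        using le_z n by simp
    next
      case False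
      then have "2 * (card (walks_to w) - 1) \<le> z * (card (walks_to w) - 1)"
        using z_ge_1 by (intro mult_right_mono) auto
      then show ?thesis
        using le_n n by linarith
    qed
  next
    case not_end: False
    \<comment> \<open>edge charges and arc charges; they overlap where an edge and an arc join \<open>w\<close> to \<open>y\<close>\<close>
    define Le where "Le = {p \<in> L. {w, snd p} \<in> E}"
    define La where "La = {p \<in> L. arc_charge (snd p) w}"
    have one: "card (walks_to (snd p)) = 1" and charge: "edge_charge (snd p) w \<or> arc_charge (snd p) w"
      if "p \<in> L" for p
    proof -
      have "snd p \<noteq> w"
        using not_end that assms(1) by (cases p) auto
      then show "card (walks_to (snd p)) = 1" "edge_charge (snd p) w \<or> arc_charge (snd p) w"
        using assms(2)[OF that] by (auto simp: charged_def split: if_splits)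
    qed
    have "L = Le \<union> La"
      using charge by (auto simp: Le_def La_def edge_charge_def)
    then have card_L: "card L \<le> card Le + card La"
      by (simp add: card_Un_le)
    have inj: "inj_on snd L"
    proof (rule inj_onI)
      fix p q assume pq: "p \<in> L" "q \<in> L" "snd p = snd q"
      obtain x y x' where xy: "p = (x, y)" "q = (x', y)"
        using pq(3) by (cases p, cases q) simp
      have "[(True, x), (False, y)] \<in> walks_to y" "[(True, x'), (False, y)] \<in> walks_to y"
        using pq(1,2) assms(1) by (auto simp: xy intro: walk_edge_arc)
      moreover have "card (walks_to y) = 1"
        using one[OF pq(1)] by (simp add: xy)
      ultimately have "[(True, x), (False, y)] = [(True, x'), (False, y)]"
        by (intro unique_walk)
      then show "p = q"
        by (simp add: xy)
    qed
    have "inj_on snd La"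
      by (rule inj_on_subset[OF inj]) (simp add: La_def)
    moreover have "snd ` La \<subseteq> {y. (w, y) \<in> A}"
      by (auto simp: La_def arc_charge_def)
    ultimately have "card La \<le> card {y. (w, y) \<in> A}"
      by (rule card_inj_on_le) simp
    then have card_La: "card La \<le> z"
      using wV by (simp add: card_out_neighbours)
    define S where "S = (\<lambda>p. [(True, fst p), (False, snd p), (True, w)]) ` Le"
    define D where "D = (if {u, w} \<in> E then {[(True, w)]} else {})"
    have finS: "finite S" "finite D"
      using finL by (auto simp: S_def Le_def D_def)
    have card_S: "card S = card Le"
      unfolding S_def by (rule card_image) (auto simp: inj_on_def prod_eq_iff)
    have S_sub: "S \<subseteq> walks_to w"
    proof
      fix s assume "s \<in> S"
      then obtain x y where "s = [(True, x), (False, y), (True, w)]" "(x, y) \<in> L" "{w, y} \<in> E"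
        by (auto simp: S_def Le_def)
      then show "s \<in> walks_to w"
        using assms(1) by (blast intro: walk_edge_arc_edge)
    qed
    have D_sub: "D \<subseteq> walks_to w"
      by (auto simp: D_def intro: walk_edge)
    have "S \<inter> D = {}" "(S \<union> D) \<inter> arc_first_walks w = {}"
      by (auto simp: S_def D_def arc_first_walks_def)
    then have "card S + card D + card (arc_first_walks w) = card (S \<union> D \<union> arc_first_walks w)"
      using finS by (simp add: card_Un_disjoint)
    also have "\<dots> \<le> card (walks_to w)"
    proof (rule card_mono)
      have "arc_first_walks w \<subseteq> walks_to w"
        by (simp add: arc_first_walks_def)
      then show "S \<union> D \<union> arc_first_walks w \<subseteq> walks_to w"
        using S_sub D_sub by blast
    qed simp
    finally have total: "card Le + card D + card (arc_first_walks w) \<le> card (walks_to w)"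
      by (simp add: card_S)
    show ?thesis
    proof (cases "La = {}")
      case True
      obtain p where p: "p \<in> L"
        using \<open>L \<noteq> {}\<close> by blast
      then have "edge_charge (snd p) w"
        using charge[OF p] True p unfolding La_def by blast
      then have "card (arc_first_walks w) \<ge> 1"
        by (simp add: edge_charge_def)
      then have "card L \<le> card (walks_to w) - 1"
        using total card_L True by simp
      also have "\<dots> \<le> z * (card (walks_to w) - 1)"
        using z_ge_1 by simp
      finally show ?thesis .
    next
      case False
      then obtain p where "arc_charge (snd p) w"
        by (auto simp: La_def)
      then have "card D + card (arc_first_walks w) \<ge> 2"
        by (auto simp: arc_charge_def D_def)
      then have "card Le + 1 \<le> card (walks_to w) - 1"
        using total by simp
      then have "z * (card Le + 1) \<le> z * (card (walks_to w) - 1)"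
        by (rule mult_le_mono2)
      moreover have "z * (card Le + 1) = z * card Le + z"
        by simp
      moreover have "card Le \<le> z * card Le"
        using mult_le_mono1[OF z_ge_1, of "card Le"] by simp
      ultimately show ?thesis
        using card_L card_La by linarith
    qed
  qed
qed simp

lemma card_vertices_le: "real (card V) \<le> moore_bound r z k - real r"
proof -
  have "\<exists>w\<in>V. charged p w" if "p \<in> edge_arc_pairs" for p
  proof (cases "card (walks_to (snd p)) = 1")
    case True
    then show ?thesis
      using charge_exists[of "fst p" "snd p"] that by (simp add: charged_def)
  next
    case False
    then show ?thesis
      using that arc_ends[of "fst p" "snd p"]
      by (intro bexI[of _ "snd p"]) (auto simp: charged_def edge_arc_pairs_def)
  qed
  then obtain f where f: "\<And>p. p \<in> edge_arc_pairs \<Longrightarrow> f p \<in> V \<and> charged p (f p)"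
    using bchoice[of edge_arc_pairs "\<lambda>p w. w \<in> V \<and> charged p w"] by blast
  have "edge_arc_pairs = (\<Union>w\<in>V. {p \<in> edge_arc_pairs. f p = w})"
    using f by blast
  then have "r * z = card (\<Union>w\<in>V. {p \<in> edge_arc_pairs. f p = w})"
    by (simp only: card_edge_arc_pairs[symmetric])
  also have "\<dots> = (\<Sum>w\<in>V. card {p \<in> edge_arc_pairs. f p = w})"
    by (rule card_UN_disjoint) (simp add: finite_vertices, simp, blast)
  also have "\<dots> \<le> (\<Sum>w\<in>V. z * (card (walks_to w) - 1))"
  proof (rule sum_mono)
    fix w assume "w \<in> V"
    then show "card {p \<in> edge_arc_pairs. f p = w} \<le> z * (card (walks_to w) - 1)"
      using f by (intro load_le) blast+
  qed
  also have "\<dots> = z * (\<Sum>w\<in>V. card (walks_to w) - 1)"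
    by (simp add: sum_distrib_left)
  finally have "r \<le> (\<Sum>w\<in>V. card (walks_to w) - 1)"
    using z_ge_1 by (simp add: mult.commute)
  moreover have "(\<Sum>w\<in>V. card (walks_to w) - 1) + card V = (\<Sum>w\<in>V. card (walks_to w))"
  proof -
    have "(\<Sum>w\<in>V. card (walks_to w) - 1) + card V = (\<Sum>w\<in>V. (card (walks_to w) - 1) + 1)"
      by (simp add: sum.distrib del: One_nat_def)
    also have "\<dots> = (\<Sum>w\<in>V. card (walks_to w))"
      using card_walks_to_pos by (intro sum.cong refl le_add_diff_inverse2)
    finally show ?thesis .
  qed
  ultimately have "r + card V \<le> (\<Sum>w\<in>V. card (walks_to w))"
    by simp
  then have "real (r + card V) \<le> moore_bound r z k"
    unfolding sum_card_walks_to[symmetric] by (rule of_nat_mono)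
  then show ?thesis
    by simp
qed

end

section \<open>The improved bound\<close>

lemma nb_walk_of_diameter:
  assumes "mixed_diameter V E A = enat k" and "x \<in> V" "y \<in> V"
  shows "\<exists>s. nb_walk E A None x s \<and> length s \<le> k \<and> walk_end x s = y"
proof -
  have "mixed_dist V E A x y \<le> enat k"
    unfolding assms(1)[symmetric] mixed_diameter_def
    using assms(2,3) SUP_upper[of "(x, y)" "V \<times> V" "\<lambda>(u, v). mixed_dist V E A u v"] by simp
  also have "enat k < enat (Suc k)"
    by simp
  finally obtain p where p: "mixed_path V E A x p y" "length p - 1 < Suc k"
    unfolding mixed_dist_def by (auto simp: INF_less_iff)
  then obtain q where q: "p = x # q"
    by (cases p) (auto simp: mixed_path_def)
  obtain s where "nb_walk E A None x s" "map snd s = q"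
    using nb_walk_of_distinct[of E A x q None] p(1) by (auto simp: q mixed_path_def)
  then show ?thesis
    using p length_map[of snd s] by (intro exI[of _ s]) (auto simp: q mixed_path_def walk_end_def)
qed

theorem theorem2p1:
  fixes V :: "'a set" and E :: "'a set set" and A :: "('a \<times> 'a) set"
    and r z k :: nat
  assumes "mixed_graph V E A"
    and "totally_regular V E A r z"
    and "z \<ge> 1"
    and "mixed_diameter V E A = enat k"
    and "k \<ge> 3"
  shows "real (card V) \<le> moore_bound r z k - real r"
proof -
  have "V \<noteq> {}"
  proof
    assume "V = {}"
    then have "mixed_diameter V E A = 0"
      by (simp add: mixed_diameter_def bot_enat_def)
    then show False
      using assms(4,5) by (simp add: zero_enat_def)
  qed
  then obtain u where u: "u \<in> V"
    by blast
  interpret mixed_graph V E A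
    by (rule assms(1))
  interpret rooted_mixed_graph V E A r z k u
    by unfold_locales (use assms u nb_walk_of_diameter[OF assms(4)] in auto)
  show ?thesis
    by (rule card_vertices_le)
qed

end
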